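(* Let $n$ be a positive integer, $k$ a field, $\mathfrak{gl}_n$ the Lie algebra of $n\times n$ matrices with entries in $k$, $\mathfrak{b}_0\subset\mathfrak{gl}_n$ the Borel subalgebra of upper triangular matrices, and for $g\in\mathrm{GL}_n(k)$ put $\mathfrak{b}_g=g^{-1}\mathfrak{b}_0g$. Let $\mathfrak{S}_n$ be the symmetric group on $n$ letters, viewed as the subgroup of permutation matrices in $\mathrm{GL}_n(k)$. Then any Borel subalgebra $\mathfrak{b}\subset\mathfrak{gl}_n$ coincides with the linear envelope (sum of $k$-subspaces) of its intersections with the conjugates of $\mathfrak{b}_0$ under $\mathfrak{S}_n$: $$\mathfrak{b}=\sum_{w\in\mathfrak{S}_n}\mathfrak{b}\cap\mathfrak{b}_w .$$
   Context: The field $k$ is arbitrary. The Borel subalgebras of $\mathfrak{gl}_n$ are the conjugates $\mathfrak{b}_g=g^{-1}\mathfrak{b}_0g$, $g\in\mathrm{GL}_n(k)$, of the algebra of upper triangular matrices. *)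

theory Defs
  imports "Jordan_Normal_Form.Matrix" "HOL-Combinatorics.Permutations"
begin

text \<open>Only the linear structure and the associative product of
  \<open>gl\<^sub>n = carrier_mat n n\<close> enter below, so the Lie bracket is not introduced.\<close>

definition GL :: "nat \<Rightarrow> 'a :: field mat set" where
  "GL n = Units (ring_mat TYPE('a) n ())"

definition mat_inv :: "nat \<Rightarrow> 'a :: field mat \<Rightarrow> 'a mat" where
  "mat_inv n g = inv\<^bsub>ring_mat TYPE('a) n ()\<^esub> g"

definition borel0 :: "nat \<Rightarrow> 'a :: field mat set" where
  "borel0 n = {x \<in> carrier_mat n n. upper_triangular x}"

definition borel :: "nat \<Rightarrow> 'a :: field mat \<Rightarrow> 'a mat set" where
  "borel n g = {mat_inv n g * x * g | x. x \<in> borel0 n}"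

definition borel_subalgebra :: "nat \<Rightarrow> 'a :: field mat set \<Rightarrow> bool" where
  "borel_subalgebra n \<bb> \<longleftrightarrow> (\<exists>g \<in> GL n. \<bb> = borel n g)"

text \<open>The permutation matrix of \<open>w\<close> sends the basis vector \<open>e\<^sub>j\<close> to \<open>e\<^bsub>w j\<^esub>\<close>, so that
  \<open>w \<mapsto> perm_mat n w\<close> is multiplicative. The \<open>n\<close> letters are \<open>0, \<dots>, n - 1\<close>,
  matching the indices of matrix entries.\<close>

definition perm_mat :: "nat \<Rightarrow> (nat \<Rightarrow> nat) \<Rightarrow> 'a :: field mat" where
  "perm_mat n w = mat n n (\<lambda>(i, j). if i = w j then 1 else 0)"

definition sum_of_subspaces ::
  "nat \<Rightarrow> 'i set \<Rightarrow> ('i \<Rightarrow> 'a :: field mat set) \<Rightarrow> 'a mat set" where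
  "sum_of_subspaces n I U =
     {(\<Oplus>\<^bsub>module_mat TYPE('a) n n\<^esub> i \<in> I. x i) | x. x \<in> (\<Pi> i \<in> I. U i)}"

lemma perm_mat_mult:
  assumes "v permutes {..<n}" "w permutes {..<n}"
  shows "perm_mat n v * perm_mat n w = (perm_mat n (v \<circ> w) :: 'a :: field mat)"
proof (rule eq_matI)
  fix i j assume "i < dim_row (perm_mat n (v \<circ> w) :: 'a mat)"
    "j < dim_col (perm_mat n (v \<circ> w) :: 'a mat)"
  then have ij: "i < n" "j < n" by (auto simp: perm_mat_def)
  then have wj: "w j < n" using permutes_in_image[OF assms(2), of j] by auto
  have "(perm_mat n v * perm_mat n w :: 'a mat) $$ (i, j)
      = (\<Sum>k = 0..<n. (if i = v k then 1 else 0) * (if k = w j then 1 else 0))"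
    using ij by (simp add: perm_mat_def scalar_prod_def)
  also have "\<dots> = (\<Sum>k = 0..<n. if k = w j then (if i = v (w j) then 1 else 0) else 0)"
    by (rule sum.cong) auto
  also have "\<dots> = (perm_mat n (v \<circ> w) :: 'a mat) $$ (i, j)"
    using ij wj by (simp add: perm_mat_def)
  finally show "(perm_mat n v * perm_mat n w :: 'a mat) $$ (i, j)
      = perm_mat n (v \<circ> w) $$ (i, j)" .
qed (auto simp: perm_mat_def)

lemma perm_mat_GL:
  assumes w: "w permutes {..<n}"
  shows "(perm_mat n w :: 'a :: field mat) \<in> GL n"
proof -
  have id: "perm_mat n id = (1\<^sub>m n :: 'a mat)"
    by (rule eq_matI) (auto simp: perm_mat_def)
  have w': "inv_into UNIV w permutes {..<n}" by (rule permutes_inv[OF w])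
  have "perm_mat n (inv_into UNIV w) * perm_mat n w = (1\<^sub>m n :: 'a mat)"
    "perm_mat n w * perm_mat n (inv_into UNIV w) = (1\<^sub>m n :: 'a mat)"
    unfolding perm_mat_mult[OF w' w] perm_mat_mult[OF w w']
      permutes_inv_o(1)[OF w] permutes_inv_o(2)[OF w] by (rule id)+
  moreover have "(perm_mat n v :: 'a mat) \<in> carrier_mat n n" for v
    by (simp add: perm_mat_def)
  ultimately show ?thesis
    unfolding GL_def Units_def ring_mat_def by auto
qed

end

theory Submission
  imports Defs
begin

text \<open>Column operations by upper triangular matrices do not change \<open>Q borel0 Q\<inverse>\<close>, and they
  bring \<open>Q = g\<inverse>\<close> to an echelon form in which the pivot rows \<open>p 0, p 1, \<dots>\<close> form a permutation
  \<open>p\<close> and \<open>Q (p j, i) = 0\<close> for \<open>j < i\<close>. Writing \<open>f\<^sub>i\<close> for the columns of \<open>Q\<close>, let \<open>\<phi>\<^sub>i\<^sub>t\<close> be the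
  \<open>t\<close>-th coordinate of the projection along \<open>f\<^sub>0, \<dots>, f\<^bsub>i-1\<^esub>\<close> onto the span of the remaining
  columns. The rank one matrices \<open>f\<^sub>i \<phi>\<^sub>i\<^sub>t\<close> span the Borel subalgebra. Modulo \<open>p\<close> the support of
  \<open>f\<^sub>i\<close> lies in \<open>{i..}\<close> and that of \<open>\<phi>\<^sub>i\<^sub>t\<close> in \<open>{..<i} \<union> {t}\<close>, so that the two meet in at most
  one index and the coordinates can be reordered to make \<open>f\<^sub>i \<phi>\<^sub>i\<^sub>t\<close> upper triangular.\<close>

section \<open>Additively closed sets of matrices and sums of subspaces\<close>

text \<open>A sum of subspaces is built by addition alone, scalars being absorbed by the summands,
  so additive submonoids are the convenient setting.\<close>

definition add_closed :: "nat \<Rightarrow> 'a :: field mat set \<Rightarrow> bool" where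
  "add_closed n S \<longleftrightarrow>
     S \<subseteq> carrier_mat n n \<and> 0\<^sub>m n n \<in> S \<and> (\<forall>x\<in>S. \<forall>y\<in>S. x + y \<in> S)"

lemma add_closed_Int: "add_closed n S \<Longrightarrow> add_closed n T \<Longrightarrow> add_closed n (S \<inter> T)"
  unfolding add_closed_def by auto

lemma mult_mat_index:
  assumes "A \<in> carrier_mat n n" "B \<in> carrier_mat n n" "i < n" "j < n"
  shows "(A * B) $$ (i, j) = (\<Sum>k<n. A $$ (i, k) * B $$ (k, j))"
  using assms by (auto simp: scalar_prod_def lessThan_atLeast0 intro!: sum.cong)

text \<open>The sum is taken inside the entries of a single matrix, so that a decomposition can be
  checked entry by entry.\<close>

lemma add_closed_sum:
  assumes S: "add_closed n S" and e: "\<And>f. f \<in> F \<Longrightarrow> mat n n (e f) \<in> S"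
  shows "mat n n (\<lambda>ij. \<Sum>f\<in>F. e f ij) \<in> S"
  using e
proof (induction F rule: infinite_finite_induct)
  case (insert f F)
  have "mat n n (\<lambda>ij. \<Sum>f\<in>insert f F. e f ij) = mat n n (e f) + mat n n (\<lambda>ij. \<Sum>f\<in>F. e f ij)"
    using insert.hyps by (intro eq_matI) auto
  then show ?case using insert S by (auto simp: add_closed_def)
qed (use S in \<open>auto simp: add_closed_def zero_mat_def\<close>)

text \<open>Induction on the index set; over an infinite one the module sum is \<open>0\<close> by
  convention, which lies in \<open>S\<close> too.\<close>

lemma sum_of_subspaces_least:
  assumes S: "add_closed n S" and U: "\<And>i. i \<in> I \<Longrightarrow> U i \<subseteq> S"
  shows "sum_of_subspaces n I U \<subseteq> S"
proof -
  interpret M: abelian_group "module_mat TYPE('a) n n" by (rule abelian_group_mat)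
  have "(\<Oplus>\<^bsub>module_mat TYPE('a) n n\<^esub> i \<in> I. x i) \<in> S" if "x \<in> (\<Pi> i \<in> I. U i)" for x
    using that U
  proof (induction I rule: infinite_finite_induct)
    case (insert i I)
    have car: "x \<in> I \<rightarrow> carrier (module_mat TYPE('a) n n)"
      "x i \<in> carrier (module_mat TYPE('a) n n)"
      using insert.prems S by (force simp: add_closed_def module_mat_simps)+
    have "x i \<in> S" "(\<Oplus>\<^bsub>module_mat TYPE('a) n n\<^esub> i \<in> I. x i) \<in> S"
      using insert by auto
    then show ?case
      using insert.hyps car S by (simp add: M.finsum_insert add_closed_def module_mat_simps)
  qed (use S in \<open>auto simp: add_closed_def module_mat_simps\<close>)
  then show ?thesis by (auto simp: sum_of_subspaces_def)
qed

lemma add_closed_sum_of_subspaces: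
  assumes U: "\<And>i. i \<in> I \<Longrightarrow> add_closed n (U i)"
  shows "add_closed n (sum_of_subspaces n I U :: 'a :: field mat set)"
proof -
  let ?M = "module_mat TYPE('a) n n"
  interpret M: abelian_group ?M by (rule abelian_group_mat)
  have car: "x \<in> I \<rightarrow> carrier ?M" if "x \<in> (\<Pi> i \<in> I. U i)" for x
    using that U by (force simp: add_closed_def module_mat_simps)
  have "sum_of_subspaces n I U \<subseteq> carrier_mat n n"
    using M.finsum_closed[OF car] by (auto simp: sum_of_subspaces_def module_mat_simps)
  moreover have "0\<^sub>m n n \<in> sum_of_subspaces n I U"
  proof -
    have "0\<^sub>m n n = (\<Oplus>\<^bsub>?M\<^esub> i \<in> I. \<zero>\<^bsub>?M\<^esub>)" 
      unfolding M.finsum_zero by (simp add: module_mat_simps)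
    moreover have "(\<lambda>i. \<zero>\<^bsub>?M\<^esub>) \<in> (\<Pi> i \<in> I. U i)"
      using U by (auto simp: add_closed_def module_mat_simps)
    ultimately show ?thesis unfolding sum_of_subspaces_def by blast
  qed
  moreover have "a + b \<in> sum_of_subspaces n I U"
    if "a \<in> sum_of_subspaces n I U" "b \<in> sum_of_subspaces n I U" for a b
  proof -
    obtain x y where x: "x \<in> (\<Pi> i \<in> I. U i)" "a = (\<Oplus>\<^bsub>?M\<^esub> i \<in> I. x i)"
      and y: "y \<in> (\<Pi> i \<in> I. U i)" "b = (\<Oplus>\<^bsub>?M\<^esub> i \<in> I. y i)"
      using \<open>a \<in> _\<close> \<open>b \<in> _\<close> by (auto simp: sum_of_subspaces_def)
    have "a + b = (\<Oplus>\<^bsub>?M\<^esub> i \<in> I. x i + y i)"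
      using M.finsum_addf[OF car[OF x(1)] car[OF y(1)]] x(2) y(2)
      by (simp add: module_mat_simps)
    moreover have "(\<lambda>i. x i + y i) \<in> (\<Pi> i \<in> I. U i)"
      using x(1) y(1) U by (auto simp: add_closed_def Pi_iff)
    ultimately show ?thesis unfolding sum_of_subspaces_def by blast
  qed
  ultimately show ?thesis by (auto simp: add_closed_def)
qed

lemma subset_sum_of_subspaces:
  assumes U: "\<And>i. i \<in> I \<Longrightarrow> add_closed n (U i)" and I: "finite I" "i \<in> I"
  shows "U i \<subseteq> (sum_of_subspaces n I U :: 'a :: field mat set)"
proof
  let ?M = "module_mat TYPE('a) n n"
  interpret M: abelian_group ?M by (rule abelian_group_mat)
  fix z assume z: "z \<in> U i"
  then have car: "(\<lambda>_. z) \<in> I \<rightarrow> carrier ?M"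
    using U I by (auto simp: add_closed_def module_mat_simps)
  \<comment> \<open>The family concentrated at \<open>i\<close>. Finiteness of \<open>I\<close>
    makes its module sum \<open>z\<close> rather than the default \<open>0\<close>.\<close>
  define x where "x j = (if i = j then z else \<zero>\<^bsub>?M\<^esub>)" for j
  have "z = (\<Oplus>\<^bsub>?M\<^esub> j \<in> I. x j)"
    using M.finsum_singleton[OF I(2,1) car] unfolding x_def by simp
  moreover have "x \<in> (\<Pi> i \<in> I. U i)"
    using z U by (auto simp: x_def add_closed_def module_mat_simps)
  ultimately show "z \<in> sum_of_subspaces n I U" unfolding sum_of_subspaces_def by blast
qed

section \<open>Inverses and Borel subalgebras in explicit form\<close>

lemma mat_inv_eq:
  assumes "(g :: 'a :: field mat) \<in> carrier_mat n n" "h \<in> carrier_mat n n"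
    "g * h = 1\<^sub>m n" "h * g = 1\<^sub>m n"
  shows "mat_inv n g = h"
proof -
  interpret R: ring "ring_mat TYPE('a) n ()" by (rule ring_mat)
  show ?thesis unfolding mat_inv_def
    by (rule R.inv_char) (use assms in \<open>auto simp: ring_mat_simps\<close>)
qed

lemma GL_inverse:
  assumes "g \<in> GL n"
  obtains h where "g \<in> carrier_mat n n" "h \<in> carrier_mat n n" "g * h = 1\<^sub>m n" "h * g = 1\<^sub>m n"
  using assms unfolding GL_def Units_def by (auto simp: ring_mat_simps)

text \<open>Trades \<open>mat_inv\<close> for any explicit two-sided inverse, leaving only matrix
  products to compute with.\<close>

lemma borel_eq:
  assumes "g \<in> carrier_mat n n" "h \<in> carrier_mat n n" "g * h = 1\<^sub>m n" "h * g = 1\<^sub>m n"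
  shows "borel n g = {h * x * g | x. x \<in> borel0 n}"
  unfolding borel_def mat_inv_eq[OF assms] ..

lemma borel0_closed: "x \<in> borel0 n \<Longrightarrow> x \<in> carrier_mat n n"
  by (simp add: borel0_def)

lemma add_closed_borel0: "add_closed n (borel0 n)"
  by (auto simp: add_closed_def borel0_def upper_triangular_def)

lemma borel0_mult:
  assumes "x \<in> borel0 n" "y \<in> borel0 n"
  shows "x * y \<in> borel0 n"
proof -
  have c: "x \<in> carrier_mat n n" "y \<in> carrier_mat n n" using assms borel0_closed by auto
  have "(x * y) $$ (i, j) = 0" if "j < i" "i < n" for i j
  proof -
    have "x $$ (i, k) * y $$ (k, j) = 0" if "k < n" for k
      using assms c \<open>j < i\<close> \<open>i < n\<close> that
      by (cases "k < i") (auto simp: borel0_def upper_triangular_def)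
    then show ?thesis using mult_mat_index[OF c] that by (simp del: mult_eq_0_iff)
  qed
  then show ?thesis using c by (auto simp: borel0_def upper_triangular_def)
qed

lemma add_closed_borel:
  assumes "g \<in> GL n"
  shows "add_closed n (borel n g)"
proof -
  obtain h where g: "g \<in> carrier_mat n n" "h \<in> carrier_mat n n" "g * h = 1\<^sub>m n" "h * g = 1\<^sub>m n"
    using GL_inverse[OF assms] .
  have "\<exists>z. h * x * g + h * y * g = h * z * g \<and> z \<in> borel0 n"
    if "x \<in> borel0 n" "y \<in> borel0 n" for x y
  proof (intro exI conjI)
    show "x + y \<in> borel0 n" using add_closed_borel0 that by (auto simp: add_closed_def)
    show "h * x * g + h * y * g = h * (x + y) * g"
      using that[THEN borel0_closed] g(1,2)
      by (simp add: mult_add_distrib_mat[of h n n] add_mult_distrib_mat[of _ n n])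
  qed
  moreover have "\<exists>z. 0\<^sub>m n n = h * z * g \<and> z \<in> borel0 n"
    using add_closed_borel0 g(1,2) by (intro exI[of _ "0\<^sub>m n n"]) (auto simp: add_closed_def)
  ultimately show ?thesis
    unfolding borel_eq[OF g] add_closed_def using g(1,2) borel0_closed by auto
qed

section \<open>Permutation matrices and their Borel subalgebras\<close>

lemma perm_mat_closed: "perm_mat n w \<in> carrier_mat n n"
  by (simp add: perm_mat_def)

lemma perm_mat_id: "perm_mat n id = 1\<^sub>m n"
  by (rule eq_matI) (auto simp: perm_mat_def)

lemma mult_perm_mat_index:
  assumes x: "x \<in> carrier_mat n n" and w: "w permutes {..<n}" and "i < n" "j < n"
  shows "(x * perm_mat n w) $$ (i, j) = x $$ (i, w j)"
proof -
  have "w j < n" using permutes_in_image[OF w, of j] \<open>j < n\<close> by simp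
  have "(x * perm_mat n w) $$ (i, j) = (\<Sum>k<n. if k = w j then x $$ (i, w j) else 0)"
    unfolding mult_mat_index[OF x perm_mat_closed \<open>i < n\<close> \<open>j < n\<close>]
    using \<open>j < n\<close> by (intro sum.cong) (auto simp: perm_mat_def)
  then show ?thesis using \<open>w j < n\<close> by simp
qed

lemma perm_mat_inv_mult_index:
  assumes x: "x \<in> carrier_mat n n" and w: "w permutes {..<n}" and "i < n" "j < n"
  shows "(perm_mat n (inv_into UNIV w) * x) $$ (i, j) = x $$ (w i, j)"
proof -
  have "w i < n" using permutes_in_image[OF w, of i] \<open>i < n\<close> by simp
  have iff: "i = inv_into UNIV w k \<longleftrightarrow> k = w i" for k using permutes_inverses[OF w] by metis
  have "(perm_mat n (inv_into UNIV w) * x) $$ (i, j)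
      = (\<Sum>k<n. if k = w i then x $$ (w i, j) else 0)"
    unfolding mult_mat_index[OF perm_mat_closed x \<open>i < n\<close> \<open>j < n\<close>]
    using \<open>i < n\<close> by (intro sum.cong) (simp_all add: perm_mat_def iff)
  then show ?thesis using \<open>w i < n\<close> by simp
qed

text \<open>Conjugation by the permutation matrix relabels the index \<open>a\<close> as
  \<open>w a\<close>, so it is enough that the support be upper triangular in the order of the
  labels.\<close>

lemma borel_perm_matI:
  fixes x :: "'a :: field mat"
  assumes w: "w permutes {..<n}" and x: "x \<in> carrier_mat n n"
    and tri: "\<And>a c. a < n \<Longrightarrow> c < n \<Longrightarrow> w c < w a \<Longrightarrow> x $$ (a, c) = 0"
  shows "x \<in> borel n (perm_mat n w)"
proof -
  define v where "v = inv_into UNIV w"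
  have v: "v permutes {..<n}" unfolding v_def by (rule permutes_inv[OF w])
  have wv: "w (v i) = i" "v (w i) = i" for i
    unfolding v_def using permutes_inverses[OF w] by auto
  have lt: "v i < n \<longleftrightarrow> i < n" "w i < n \<longleftrightarrow> i < n" for i
    using permutes_in_image[OF v] permutes_in_image[OF w] by auto
  have inv: "perm_mat n w * perm_mat n v = (1\<^sub>m n :: 'a mat)"
    "perm_mat n v * perm_mat n w = (1\<^sub>m n :: 'a mat)"
    using perm_mat_mult[OF w v, where 'a = 'a] perm_mat_mult[OF v w, where 'a = 'a] perm_mat_id
    unfolding v_def permutes_inv_o[OF w] by auto
  define u where "u = mat n n (\<lambda>(i, j). x $$ (v i, v j))"
  have "u \<in> borel0 n"
    using tri lt wv by (auto simp: borel0_def u_def upper_triangular_def)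
  moreover have "x = perm_mat n v * u * perm_mat n w"
  proof (rule eq_matI)
    fix i j assume "i < dim_row (perm_mat n v * u * perm_mat n w)"
      "j < dim_col (perm_mat n v * u * perm_mat n w)"
    then have ij: "i < n" "j < n" by (auto simp: perm_mat_def)
    have u: "u \<in> carrier_mat n n" by (simp add: u_def)
    then have "perm_mat n v * u \<in> carrier_mat n n" by (rule mult_carrier_mat[OF perm_mat_closed])
    then show "x $$ (i, j) = (perm_mat n v * u * perm_mat n w) $$ (i, j)"
      using ij lt wv perm_mat_inv_mult_index[OF u w, folded v_def]
      by (simp add: mult_perm_mat_index[OF _ w] u_def)
  qed (use x in \<open>auto simp: perm_mat_def\<close>)
  ultimately show ?thesis unfolding borel_eq[OF perm_mat_closed perm_mat_closed inv] by blast
qed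

section \<open>Column operations and echelon form\<close>

text \<open>Multiplied on the right, it adds \<open>c j\<close> times column \<open>k\<close> to
  each column \<open>j > k\<close>, so a single factor can clear a whole row beyond its
  pivot.\<close>

definition row_shear :: "nat \<Rightarrow> nat \<Rightarrow> (nat \<Rightarrow> 'a) \<Rightarrow> 'a :: field mat" where
  "row_shear n k c = mat n n (\<lambda>(i, j). if i = j then 1 else if i = k \<and> k < j then c j else 0)"

lemma row_shear_closed: "row_shear n k c \<in> carrier_mat n n"
  by (simp add: row_shear_def)

lemma row_shear_borel0: "row_shear n k c \<in> borel0 n"
  by (auto simp: row_shear_def borel0_def upper_triangular_def)

lemma mult_row_shear_index:
  assumes Q: "Q \<in> carrier_mat n n" and "k < n" "i < n" "j < n"
  shows "(Q * row_shear n k c) $$ (i, j)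
    = Q $$ (i, j) + (if k < j then Q $$ (i, k) * c j else 0)"
proof -
  have "(Q * row_shear n k c) $$ (i, j)
      = (\<Sum>l<n. (if l = j then Q $$ (i, j) else 0)
          + (if l = k then (if k < j then Q $$ (i, k) * c j else 0) else 0))"
    unfolding mult_mat_index[OF Q row_shear_closed \<open>i < n\<close> \<open>j < n\<close>]
    using \<open>j < n\<close> by (intro sum.cong) (auto simp: row_shear_def)
  then show ?thesis using assms by (simp add: sum.distrib)
qed

lemma row_shear_mult_uminus:
  assumes "k < n"
  shows "row_shear n k c * row_shear n k (\<lambda>j. - c j) = 1\<^sub>m n"
proof (rule eq_matI)
  fix i j assume "i < dim_row (1\<^sub>m n :: 'a mat)" "j < dim_col (1\<^sub>m n :: 'a mat)"
  then show "(row_shear n k c * row_shear n k (\<lambda>j. - c j)) $$ (i, j) = 1\<^sub>m n $$ (i, j)"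
    using assms by (auto simp: mult_row_shear_index[OF row_shear_closed])
      (auto simp: row_shear_def)
qed (auto simp: row_shear_def)

text \<open>Induction on the number of pivots. Column \<open>k\<close> of the invertible
  \<open>Q\<close> has a nonzero entry; its row \<open>r\<close> becomes the next pivot row and is
  cleared to the right by a column operation.\<close>

lemma borel_echelon_aux:
  fixes g :: "'a :: field mat"
  assumes g: "g \<in> GL n" and "k \<le> n"
  shows "\<exists>Q R p. Q \<in> carrier_mat n n \<and> R \<in> carrier_mat n n \<and> Q * R = 1\<^sub>m n \<and> R * Q = 1\<^sub>m n
    \<and> borel n g = {Q * x * R | x. x \<in> borel0 n}
    \<and> (\<forall>j<k. p j < n \<and> Q $$ (p j, j) \<noteq> 0 \<and> (\<forall>i<n. j < i \<longrightarrow> Q $$ (p j, i) = 0))"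
  using \<open>k \<le> n\<close>
proof (induction k)
  case 0
  obtain h where gh: "g \<in> carrier_mat n n" "h \<in> carrier_mat n n" "g * h = 1\<^sub>m n" "h * g = 1\<^sub>m n"
    using GL_inverse[OF g] .
  \<comment> \<open>Start from the inverse \<open>h\<close> of \<open>g\<close>; with no pivots yet,
    \<open>id\<close> is a mere placeholder.\<close>
  show ?case using gh borel_eq[OF gh]
    by (intro exI[of _ h] exI[of _ g] exI[of _ id] conjI) auto
next
  case (Suc k)
  then have k: "k < n" by simp
  obtain Q R p where Q: "Q \<in> carrier_mat n n" and R: "R \<in> carrier_mat n n"
    and QR: "Q * R = 1\<^sub>m n" "R * Q = 1\<^sub>m n"
    and b: "borel n g = {Q * x * R | x. x \<in> borel0 n}"
    and piv: "\<forall>j<k. p j < n \<and> Q $$ (p j, j) \<noteq> 0 \<and> (\<forall>i<n. j < i \<longrightarrow> Q $$ (p j, i) = 0)"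
    using Suc.IH[OF less_imp_le[OF k]] by (elim exE conjE)
  have p: "\<And>j. j < k \<Longrightarrow> p j < n" "\<And>j. j < k \<Longrightarrow> Q $$ (p j, j) \<noteq> 0"
    "\<And>j i. j < k \<Longrightarrow> i < n \<Longrightarrow> j < i \<Longrightarrow> Q $$ (p j, i) = 0"
    using piv by blast+
  have "\<exists>r<n. Q $$ (r, k) \<noteq> 0"
  proof (rule ccontr)
    assume "\<not> ?thesis"
    then have "(R * Q) $$ (k, k) = 0" unfolding mult_mat_index[OF R Q k k] by simp
    then show False using QR k by simp
  qed
  then obtain r where r: "r < n" "Q $$ (r, k) \<noteq> 0" by blast
  \<comment> \<open>Chosen so that \<open>Q $$ (r, j) + Q $$ (r, k) * c j = 0\<close>.\<close>
  define c where "c j = - Q $$ (r, j) / Q $$ (r, k)" for j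
  define T where "T = row_shear n k c"
  define T' where "T' = row_shear n k (\<lambda>j. - c j)"
  have T: "T \<in> carrier_mat n n" "T' \<in> carrier_mat n n" "T \<in> borel0 n" "T' \<in> borel0 n"
    unfolding T_def T'_def by (simp_all add: row_shear_closed row_shear_borel0)
  have TT: "T * T' = 1\<^sub>m n" "T' * T = 1\<^sub>m n"
    using row_shear_mult_uminus[OF k, of c] row_shear_mult_uminus[OF k, of "\<lambda>j. - c j"]
    unfolding T_def T'_def by simp_all
  have QT: "(Q * T) $$ (i, j) = Q $$ (i, j) + (if k < j then Q $$ (i, k) * c j else 0)"
    if "i < n" "j < n" for i j
    unfolding T_def using mult_row_shear_index[OF Q k that] .
  note assoc = assoc_mult_mat[of _ n n _ n _ n]
  have cancel: "T * (T' * D) = D" "R * (Q * D) = D" if "D \<in> carrier_mat n n" for D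
    using that T Q R TT QR by (simp_all flip: assoc)
  have "(Q * T) * (T' * R) = 1\<^sub>m n" using Q R T QR by (simp add: assoc cancel)
  moreover have "(T' * R) * (Q * T) = 1\<^sub>m n" using Q R T TT by (simp add: assoc cancel)
  \<comment> \<open>Both \<open>T\<close> and its inverse \<open>T'\<close> are upper triangular, so
    conjugation by \<open>T\<close> maps \<open>borel0 n\<close> onto itself and the new basis
    describes the same Borel subalgebra.\<close>
  moreover have "borel n g = {(Q * T) * x * (T' * R) | x. x \<in> borel0 n}"
  proof (intro equalityI subsetI)
    fix z assume "z \<in> borel n g"
    then obtain x where x: "z = Q * x * R" "x \<in> borel0 n" using b by auto
    have "T' * x * T \<in> borel0 n" using x T by (simp add: borel0_mult)
    moreover have "z = (Q * T) * (T' * x * T) * (T' * R)"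
      using x borel0_closed[OF x(2)] Q R T by (simp add: assoc cancel)
    ultimately show "z \<in> {(Q * T) * x * (T' * R) | x. x \<in> borel0 n}" by blast
  next
    fix z assume "z \<in> {(Q * T) * x * (T' * R) | x. x \<in> borel0 n}"
    then obtain x where x: "z = (Q * T) * x * (T' * R)" "x \<in> borel0 n" by auto
    have "T * x * T' \<in> borel0 n" using x T by (simp add: borel0_mult)
    moreover have "z = Q * (T * x * T') * R"
      using x borel0_closed[OF x(2)] Q R T by (simp add: assoc)
    ultimately show "z \<in> borel n g" using b by blast
  qed
  moreover have "\<forall>j<Suc k. (p(k := r)) j < n \<and> (Q * T) $$ ((p(k := r)) j, j) \<noteq> 0
      \<and> (\<forall>i<n. j < i \<longrightarrow> (Q * T) $$ ((p(k := r)) j, i) = 0)"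
  proof (intro allI impI)
    fix j assume "j < Suc k"
    then consider "j = k" | "j < k" by linarith
    then show "(p(k := r)) j < n \<and> (Q * T) $$ ((p(k := r)) j, j) \<noteq> 0
      \<and> (\<forall>i<n. j < i \<longrightarrow> (Q * T) $$ ((p(k := r)) j, i) = 0)"
    proof cases
      case 1
      then show ?thesis using r k by (simp add: QT c_def)
    next
      \<comment> \<open>Earlier pivot rows vanish in column \<open>k\<close>, so adding multiples of
        that column leaves them unchanged.\<close>
      case 2
      then show ?thesis using p[OF 2] p(3)[OF 2 k] k by (simp add: QT)
    qed
  qed
  ultimately show ?case
    using mult_carrier_mat[OF Q T(1)] mult_carrier_mat[OF T(2) R]
    by (intro exI[of _ "Q * T"] exI[of _ "T' * R"] exI[of _ "p(k := r)"] conjI)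
qed

lemma borel_echelon:
  fixes g :: "'a :: field mat"
  assumes g: "g \<in> GL n"
  obtains Q R p where "Q \<in> carrier_mat n n" "R \<in> carrier_mat n n" "Q * R = 1\<^sub>m n" "R * Q = 1\<^sub>m n"
    "borel n g = {Q * x * R | x. x \<in> borel0 n}" "p permutes {..<n}"
    "\<And>j. j < n \<Longrightarrow> Q $$ (p j, j) \<noteq> 0" "\<And>j i. i < n \<Longrightarrow> j < i \<Longrightarrow> Q $$ (p j, i) = 0"
proof -
  obtain Q R p where Q: "Q \<in> carrier_mat n n" "R \<in> carrier_mat n n" "Q * R = 1\<^sub>m n" "R * Q = 1\<^sub>m n"
    "borel n g = {Q * x * R | x. x \<in> borel0 n}"
    and *: "\<forall>j<n. p j < n \<and> Q $$ (p j, j) \<noteq> 0 \<and> (\<forall>i<n. j < i \<longrightarrow> Q $$ (p j, i) = 0)"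
    using borel_echelon_aux[OF g order_refl] by (elim exE conjE)
  have p: "\<And>j. j < n \<Longrightarrow> p j < n" "\<And>j. j < n \<Longrightarrow> Q $$ (p j, j) \<noteq> 0"
    "\<And>j i. i < n \<Longrightarrow> j < i \<Longrightarrow> Q $$ (p j, i) = 0"
    using * by (blast, blast, metis order.strict_trans)
  \<comment> \<open>A permutation of \<open>{..<n}\<close> must fix everything from \<open>n\<close>
    on, where \<open>p\<close> is arbitrary.\<close>
  define p' where "p' j = (if j < n then p j else j)" for j
  \<comment> \<open>For \<open>j < i\<close> row \<open>p j\<close> vanishes in column
    \<open>i\<close> and row \<open>p i\<close> does not, so the pivot rows are distinct.\<close>
  have "inj_on p' {..<n}"
    using p(2,3) by (intro linorder_inj_onI) (auto simp: p'_def, metis)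
  moreover have "p' ` {..<n} \<subseteq> {..<n}" using p(1) by (auto simp: p'_def)
  ultimately have "bij_betw p' {..<n} {..<n}"
    by (simp add: bij_betw_def endo_inj_surj)
  then have "p' permutes {..<n}" by (rule bij_imp_permutes) (simp add: p'_def)
  then show thesis using p by (intro that[OF Q]) (auto simp: p'_def)
qed

section \<open>The inverse of an echelon matrix and rank one products\<close>

text \<open>Reordering the rows by \<open>p\<close> makes \<open>Q\<close> lower triangular, hence
  also \<open>R\<close> with its columns reordered. The induction is forward substitution in row
  \<open>p m\<close> of \<open>Q * R = 1\<close>.\<close>

lemma echelon_inverse:
  fixes Q :: "'a :: field mat"
  assumes Q: "Q \<in> carrier_mat n n" "R \<in> carrier_mat n n" "Q * R = 1\<^sub>m n" and p: "p permutes {..<n}"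
    and piv: "\<And>j. j < n \<Longrightarrow> Q $$ (p j, j) \<noteq> 0"
    and ech: "\<And>j i. i < n \<Longrightarrow> j < i \<Longrightarrow> Q $$ (p j, i) = 0"
    and "m < c" "c < n"
  shows "R $$ (m, p c) = 0"
  using \<open>m < c\<close>
proof (induction m rule: less_induct)
  case (less m)
  have lt: "p m < n" "p c < n" "m < n"
    using permutes_in_image[OF p] \<open>c < n\<close> less.prems by auto
  have "p m \<noteq> p c" using permutes_inj[OF p] less.prems by (auto dest: injD)
  then have "0 = (Q * R) $$ (p m, p c)" using Q(3) lt by simp
  also have "\<dots> = (\<Sum>l<n. if l = m then Q $$ (p m, m) * R $$ (m, p c) else 0)"
    unfolding mult_mat_index[OF Q(1,2) lt(1,2)]
  proof (intro sum.cong refl)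
    \<comment> \<open>Terms with \<open>l < m\<close> vanish by induction, those with
      \<open>l > m\<close> by the echelon form.\<close>
    fix l assume "l \<in> {..<n}"
    then show "Q $$ (p m, l) * R $$ (l, p c)
        = (if l = m then Q $$ (p m, m) * R $$ (m, p c) else 0)"
      using less ech[of l m] by (cases l m rule: linorder_cases) auto
  qed
  finally show ?case using lt piv by simp
qed

text \<open>A matrix supported in row \<open>i\<close> has rank at most one; this exhibits its
  transform as column \<open>i\<close> of \<open>Q\<close> times the row vector \<open>v\<close>
  multiplied by \<open>R\<close>.\<close>

lemma mult_row_mult_index:
  fixes Q :: "'a :: field mat"
  assumes "Q \<in> carrier_mat n n" "R \<in> carrier_mat n n" "i < n" "a < n" "c < n"
  shows "(Q * mat n n (\<lambda>(l, m). if l = i then v m else 0) * R) $$ (a, c)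
    = Q $$ (a, i) * (\<Sum>m<n. v m * R $$ (m, c))"
proof -
  let ?E = "mat n n (\<lambda>(l, m). if l = i then v m else 0)"
  have E: "?E \<in> carrier_mat n n" by simp
  have QE: "(Q * ?E) $$ (a, m) = Q $$ (a, i) * v m" if "m < n" for m
  proof -
    have "(Q * ?E) $$ (a, m) = (\<Sum>l<n. if l = i then Q $$ (a, i) * v m else 0)"
      unfolding mult_mat_index[OF assms(1) E \<open>a < n\<close> that] using that by (intro sum.cong) auto
    then show ?thesis using assms by simp
  qed
  have "Q * ?E \<in> carrier_mat n n" using assms(1) by simp
  from mult_mat_index[OF this assms(2) \<open>a < n\<close> \<open>c < n\<close>] show ?thesis
    by (simp add: QE sum_distrib_left mult.assoc)
qed

text \<open>Off the pivot \<open>p s\<close>, the row factor is supported in the pivot rows \<open>p 0, \<dots>, p (i - 1)\<close>,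
  while the column factor vanishes there. Reversing the order of the pivots after exchanging
  \<open>i\<close> and \<open>s\<close> puts the support of the column factor first, ending in \<open>p s\<close>, and the
  support of the row factor from \<open>p s\<close> on.\<close>

lemma echelon_rank_one_in_borel_perm_mat:
  fixes Q :: "'a :: field mat" and \<alpha> :: 'a
  assumes Q: "Q \<in> carrier_mat n n" "R \<in> carrier_mat n n" "Q * R = 1\<^sub>m n" and p: "p permutes {..<n}"
    and piv: "\<And>j. j < n \<Longrightarrow> Q $$ (p j, j) \<noteq> 0"
    and ech: "\<And>j i. i < n \<Longrightarrow> j < i \<Longrightarrow> Q $$ (p j, i) = 0"
    and "i < n" "s < n"
  defines "E \<equiv> mat n n (\<lambda>(l, m). if l = i then (if i \<le> m then \<alpha> * Q $$ (p s, m) else 0) else 0)"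
  shows "\<exists>w. w permutes {..<n} \<and> Q * E * R \<in> borel n (perm_mat n w)"
proof -
  have car: "Q * E * R \<in> carrier_mat n n"
    unfolding E_def by (rule mult_carrier_mat[OF mult_carrier_mat[OF Q(1) mat_carrier] Q(2)])
  have ps: "p s < n" using permutes_in_image[OF p, of s] \<open>s < n\<close> by simp
  \<comment> \<open>The row factor is \<alpha> times the coordinate \<open>p s\<close> of the
    projection that kills the columns of \<open>Q\<close> before \<open>i\<close> and fixes the
    others.\<close>
  note entry = mult_row_mult_index[OF Q(1,2) \<open>i < n\<close>,
    where v = "\<lambda>m. if i \<le> m then \<alpha> * Q $$ (p s, m) else 0", folded E_def]
  show ?thesis
  proof (cases "i \<le> s")
    \<comment> \<open>For \<open>s < i\<close> row \<open>p s\<close> of \<open>Q\<close> vanishes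
      from column \<open>i\<close> on, so the matrix is zero and any \<open>w\<close>
      serves.\<close>
    case False
    then have "(Q * E * R) $$ (a, c) = 0" if "a < n" "c < n" for a c
      unfolding entry[OF that] using ech[of _ s]
      by (intro mult_eq_0_iff[THEN iffD2] disjI2 sum.neutral) auto
    then show ?thesis
      using borel_perm_matI[OF permutes_id car] permutes_id by blast
  next
    case True
    define q where "q = inv_into UNIV p"
    have q: "q permutes {..<n}" unfolding q_def by (rule permutes_inv[OF p])
    have pq: "p (q a) = a" "q (p a) = a" for a
      unfolding q_def using permutes_inverses[OF p] by auto
    define r where "r = Transposition.transpose i s \<circ> q"
    have r: "r permutes {..<n}"
      unfolding r_def using q permutes_swap_id[of i "{..<n}" s] \<open>i < n\<close> \<open>s < n\<close>
      by (intro permutes_compose) auto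
    \<comment> \<open>Letters start at \<open>0\<close>, so the reversal of \<open>r\<close> is
      \<open>n - 1 - r a\<close>.\<close>
    define w where "w a = (if a < n then n - 1 - r a else a)" for a
    have rlt: "r a < n" if "a < n" for a using permutes_in_image[OF r, of a] that by simp
    have "inj_on w {..<n}"
    proof (rule inj_onI)
      fix a b assume "a \<in> {..<n}" "b \<in> {..<n}" "w a = w b"
      then have "r a = r b" using rlt[of a] rlt[of b] by (auto simp: w_def)
      then show "a = b" using permutes_inj[OF r] by (auto dest: injD)
    qed
    moreover have "w ` {..<n} \<subseteq> {..<n}" by (auto simp: w_def)
    ultimately have "bij_betw w {..<n} {..<n}" by (simp add: bij_betw_def endo_inj_surj)
    then have w: "w permutes {..<n}" by (rule bij_imp_permutes) (simp add: w_def)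
    have "(Q * E * R) $$ (a, c) = 0" if ac: "a < n" "c < n" and "w c < w a" for a c
    proof (rule ccontr)
      assume "(Q * E * R) $$ (a, c) \<noteq> 0"
      then have nz: "Q $$ (a, i) \<noteq> 0"
        "(\<Sum>m<n. (if i \<le> m then \<alpha> * Q $$ (p s, m) else 0) * R $$ (m, c)) \<noteq> 0"
        unfolding entry[OF ac] by auto
      have qa: "i \<le> q a" using nz(1) ech[OF \<open>i < n\<close>, of "q a"] pq by (metis not_le)
      have qc: "q c < i \<or> q c = s"
      proof (rule ccontr)
        assume *: "\<not> (q c < i \<or> q c = s)"
        have qcn: "q c < n" using permutes_in_image[OF q, of c] ac by simp
        have R0: "R $$ (m, c) = 0" if "m < i" for m
          using echelon_inverse[OF Q p piv ech, of m "q c"] that * qcn pq by auto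
        have "(\<Sum>m<n. (if i \<le> m then \<alpha> * Q $$ (p s, m) else 0) * R $$ (m, c))
            = (\<Sum>m<n. \<alpha> * (Q $$ (p s, m) * R $$ (m, c)))"
          using R0 by (intro sum.cong) auto
        also have "\<dots> = \<alpha> * (Q * R) $$ (p s, c)"
          unfolding mult_mat_index[OF Q(1,2) ps ac(2)] by (simp add: sum_distrib_left)
        also have "\<dots> = 0" using * pq ps ac Q(3) by auto
        finally show False using nz(2) by simp
      qed
      \<comment> \<open>Both are compared with \<open>i\<close>: the exchange sends \<open>s\<close>
        to \<open>i\<close> and, as \<open>i \<le> s\<close>, preserves \<open>{..<i}\<close> and
        \<open>{i..}\<close>.\<close>
      have "r c \<le> r a"
        using qa qc \<open>i \<le> s\<close> by (auto simp: r_def Transposition.transpose_def)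
      then show False using \<open>w c < w a\<close> ac by (simp add: w_def)
    qed
    then show ?thesis using borel_perm_matI[OF w car] w by blast
  qed
qed

section \<open>Decomposition of a Borel subalgebra into rank one pieces\<close>

theorem theorem1p3:
  fixes n :: nat and \<bb> :: "'k :: field mat set"
  assumes "n > 0" and "borel_subalgebra n \<bb>"
  shows "\<bb> = sum_of_subspaces n {w. w permutes {..<n}} (\<lambda>w. \<bb> \<inter> borel n (perm_mat n w))"
proof (rule equalityI)
  obtain g where g: "g \<in> GL n" and \<bb>: "\<bb> = borel n g"
    using assms(2) by (auto simp: borel_subalgebra_def)
  let ?S = "sum_of_subspaces n {w. w permutes {..<n}} (\<lambda>w. \<bb> \<inter> borel n (perm_mat n w))"
  show "?S \<subseteq> \<bb>"
    using add_closed_borel[OF g] unfolding \<bb> by (rule sum_of_subspaces_least) simp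
  have U: "add_closed n (\<bb> \<inter> borel n (perm_mat n w))" if "w permutes {..<n}" for w
    unfolding \<bb> using g perm_mat_GL[OF that] by (intro add_closed_Int add_closed_borel)
  have S: "add_closed n ?S" using U by (intro add_closed_sum_of_subspaces) auto
  have sub: "\<bb> \<inter> borel n (perm_mat n w) \<subseteq> ?S" if "w permutes {..<n}" for w
    using subset_sum_of_subspaces[of "{w. w permutes {..<n}}" n
        "\<lambda>w. \<bb> \<inter> borel n (perm_mat n w)" w] U that finite_permutations[of "{..<n}"] by auto
  obtain Q R p where Q: "Q \<in> carrier_mat n n" "R \<in> carrier_mat n n" "Q * R = 1\<^sub>m n"
    and RQ: "R * Q = 1\<^sub>m n" and b: "\<bb> = {Q * x * R | x. x \<in> borel0 n}"
    and p: "p permutes {..<n}" and piv: "\<And>j. j < n \<Longrightarrow> Q $$ (p j, j) \<noteq> 0"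
    and ech: "\<And>j i. i < n \<Longrightarrow> j < i \<Longrightarrow> Q $$ (p j, i) = 0"
    by (rule borel_echelon[OF g, folded \<bb>], rule that)
  \<comment> \<open>Pulling the sum back along \<open>x \<mapsto> Q * x * R\<close> reduces the task
    to decomposing an upper triangular matrix.\<close>
  define G where "G = {x \<in> carrier_mat n n. Q * x * R \<in> ?S}"
  have G: "add_closed n G"
  proof -
    have "Q * (x + y) * R = Q * x * R + Q * y * R"
      if "x \<in> carrier_mat n n" "y \<in> carrier_mat n n" for x y
      using that Q(1,2) by (simp add: mult_add_distrib_mat[of Q n n] add_mult_distrib_mat[of _ n n])
    moreover have "Q * 0\<^sub>m n n * R = 0\<^sub>m n n" using Q(1,2) by simp
    ultimately show ?thesis using S by (auto simp: G_def add_closed_def)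
  qed
  show "\<bb> \<subseteq> ?S"
  proof
    fix z assume "z \<in> \<bb>"
    then obtain y where z: "z = Q * y * R" and y: "y \<in> borel0 n" using b by auto
    have yc: "y \<in> carrier_mat n n" using borel0_closed[OF y] .
    have yR: "y * R \<in> carrier_mat n n" using yc Q(2) by simp
    \<comment> \<open>By \<open>R * Q = 1\<close>, row \<open>i\<close> of \<open>y\<close> is the
      sum over \<open>s\<close> of \<open>(y * R) $$ (i, p s)\<close> times row \<open>p s\<close>
      of \<open>Q\<close>; \<open>e (i, s)\<close> is one such term without its entries left of the
      diagonal. This makes each summand upper triangular and, as \<open>y\<close> is so, keeps the
      total.\<close>
    define e where "e f = (\<lambda>(l, m). if l = fst f
      then (if fst f \<le> m then (y * R) $$ (fst f, p (snd f)) * Q $$ (p (snd f), m) else 0)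
      else 0)" for f
    have "mat n n (e f) \<in> G" if "f \<in> {..<n} \<times> {..<n}" for f
    proof -
      have f: "fst f < n" "snd f < n" using that by auto
      obtain w where w: "w permutes {..<n}" "Q * mat n n (e f) * R \<in> borel n (perm_mat n w)"
        using echelon_rank_one_in_borel_perm_mat[OF Q p piv ech f] unfolding e_def by blast
      have "mat n n (e f) \<in> borel0 n"
        by (auto simp: borel0_def upper_triangular_def e_def)
      then have "Q * mat n n (e f) * R \<in> \<bb>" using b by blast
      then show ?thesis using sub w by (auto simp: G_def)
    qed
    then have "mat n n (\<lambda>ij. \<Sum>f\<in>{..<n} \<times> {..<n}. e f ij) \<in> G"
      by (rule add_closed_sum[OF G])
    moreover have "mat n n (\<lambda>ij. \<Sum>f\<in>{..<n} \<times> {..<n}. e f ij) = y"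
    proof (rule eq_matI)
      fix a m assume "a < dim_row y" "m < dim_col y"
      then have am: "a < n" "m < n" using yc by auto
      have "(\<Sum>f\<in>{..<n} \<times> {..<n}. e f (a, m)) = (\<Sum>i<n. \<Sum>s<n. e (i, s) (a, m))"
        by (simp add: sum.cartesian_product)
      also have "\<dots> = (\<Sum>i<n. if i = a
          then (if a \<le> m then (\<Sum>s<n. (y * R) $$ (a, p s) * Q $$ (p s, m)) else 0) else 0)"
        by (intro sum.cong) (auto simp: e_def)
      also have "\<dots> = (if a \<le> m then (\<Sum>s<n. (y * R) $$ (a, p s) * Q $$ (p s, m)) else 0)"
        using am by simp
      also have "(\<Sum>s<n. (y * R) $$ (a, p s) * Q $$ (p s, m))
          = (\<Sum>t<n. (y * R) $$ (a, t) * Q $$ (t, m))"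
        using sum.permute[OF p, of "\<lambda>t. (y * R) $$ (a, t) * Q $$ (t, m)"] by (simp add: o_def)
      also have "\<dots> = (y * R * Q) $$ (a, m)"
        using mult_mat_index[OF yR Q(1) am] by simp
      also have "y * R * Q = y" using assoc_mult_mat[OF yc Q(2,1)] RQ yc by simp
      also have "(if a \<le> m then y $$ (a, m) else 0) = y $$ (a, m)"
        using y am yc by (auto simp: borel0_def upper_triangular_def)
      finally show "mat n n (\<lambda>ij. \<Sum>f\<in>{..<n} \<times> {..<n}. e f ij) $$ (a, m) = y $$ (a, m)"
        using am by simp
    qed (use yc in auto)
    ultimately show "z \<in> ?S" using z by (auto simp: G_def)
  qed
qed

end
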